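(* For any positive integers $n,\lambda$ with $n\geq \lambda$, there exists a directed graph $G$ on $n$ vertices with a source $s$, a sink $t$, and an $(s,t)$-min-cut of size $\lambda$, such that any dual fault-tolerant min-cut oracle for $G$ requires $\Omega(\lambda n)$ space.
   Context: Graphs are directed unweighted multigraphs with unit edge capacities. A dual fault-tolerant min-cut oracle for $G$ is a data structure that, given any set $F$ of two edges of $G$, reports the size of an $(s,t)$-min-cut in $G-F$ (the graph with the edges of $F$ deleted). *)

theory Defs
  imports Complex_Main "Graph_Theory.Digraph"
begin

text \<open>The arc \<open>(u, v, i)\<close> is the \<open>i\<close>-th parallel arc from \<open>u\<close> to \<open>v\<close>. Parallel arcs thus stay
  distinct, and naming an arc in a query also tells the oracle its endpoints.\<close>

type_synonym marc = "nat \<times> nat \<times> nat"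
type_synonym multidigraph = "(nat, marc) pre_digraph"

definition multidigraph_on :: "nat \<Rightarrow> multidigraph \<Rightarrow> bool" where
  "multidigraph_on n G \<longleftrightarrow>
     fin_digraph G \<and> verts G = {..<n} \<and>
     tail G = (\<lambda>(u, v, i). u) \<and> head G = (\<lambda>(u, v, i). v)"

definition del_arcs :: "('a, 'b) pre_digraph \<Rightarrow> 'b set \<Rightarrow> ('a, 'b) pre_digraph" where
  "del_arcs G F = G\<lparr>arcs := arcs G - F\<rparr>"

definition st_cuts :: "('a, 'b) pre_digraph \<Rightarrow> 'a \<Rightarrow> 'a \<Rightarrow> 'a set set" where
  "st_cuts G s t = {C. C \<subseteq> verts G \<and> s \<in> C \<and> t \<notin> C}"

definition cut_size :: "('a, 'b) pre_digraph \<Rightarrow> 'a set \<Rightarrow> nat" where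
  "cut_size G C = card {a \<in> arcs G. tail G a \<in> C \<and> head G a \<notin> C}"

definition min_cut_size :: "('a, 'b) pre_digraph \<Rightarrow> 'a \<Rightarrow> 'a \<Rightarrow> nat" where
  "min_cut_size G s t = Min (cut_size G ` st_cuts G s t)"

text \<open>The machine that executes queries: it maps the stored bits, the terminals and the failed
  arcs to the reported value. It is an arbitrary function, so query time and computability play
  no role. An oracle is the bit string (data and, if desired, program) that the machine runs on.\<close>

type_synonym machine = "bool list \<Rightarrow> nat \<Rightarrow> nat \<Rightarrow> marc set \<Rightarrow> nat"

definition dual_ft_oracle :: "machine \<Rightarrow> multidigraph \<Rightarrow> nat \<Rightarrow> nat \<Rightarrow> bool list \<Rightarrow> bool" where
  "dual_ft_oracle M G s t D \<longleftrightarrow>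
     (\<forall>F \<subseteq> arcs G. card F = 2 \<longrightarrow> M D s t F = min_cut_size (del_arcs G F) s t)"

end

theory Submission
  imports Defs
begin

text \<open>
  A block has an entry, an exit and \<open>2r\<close> inner vertices \<open>a\<^sub>i\<close>, \<open>b\<^sub>j\<close> (\<open>i, j < r\<close>), each on its own
  path entry--inner--exit of length two, and it carries an arc \<open>a\<^sub>i \<rightarrow> b\<^sub>j\<close> for each \<open>(i, j)\<close> in an
  arbitrary relation. When \<open>a\<^sub>i \<rightarrow> exit\<close> and \<open>entry \<rightarrow> b\<^sub>j\<close> fail, the arc \<open>a\<^sub>i \<rightarrow> b\<^sub>j\<close> repairs one of the
  two broken paths, so the min-cut drops by one if \<open>(i, j)\<close> is in the relation and by two otherwise.
  A block thus stores \<open>r\<^sup>2\<close> bits on \<open>O(r)\<close> vertices. With \<open>r \<approx> \<lambda>/4\<close> and \<open>\<Theta>(n/\<lambda>)\<close> blocks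
  in series, followed by a bundle of \<open>\<lambda>\<close> parallel arcs, \<open>\<Omega>(\<lambda> n)\<close> bits can be recovered from the
  answers. Since there are fewer than \<open>2^m\<close> bit strings shorter than \<open>m\<close>, one of the encoded graphs
  has only large oracles.
\<close>

section \<open>Counting bit strings\<close>

lemma card_bool_lists_shorter: "card {D :: bool list. length D < m} < 2 ^ m"
proof (induction m)
  case 0
  show ?case by simp
next
  case (Suc m)
  have "{D :: bool list. length D < Suc m} = {D. length D < m} \<union> {D. length D = m}"
    by auto
  moreover have "card {D :: bool list. length D = m} = 2 ^ m"
    using card_lists_length_eq[of "UNIV :: bool set" m] by simp
  ultimately have "card {D :: bool list. length D < Suc m} \<le> card {D :: bool list. length D < m} + 2 ^ m"
    by (metis card_Un_le)
  with Suc.IH show ?case by simp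
qed

text \<open>Pigeonhole: a choice of a code shorter than \<open>card U\<close> for every subset would
  inject \<open>2 ^ card U\<close> subsets into fewer bit strings.\<close>

lemma exists_subset_with_long_codes:
  fixes P :: "'a set \<Rightarrow> bool list \<Rightarrow> bool"
  assumes "finite U"
    and inj: "\<And>A A' D. \<lbrakk>A \<subseteq> U; A' \<subseteq> U; P A D; P A' D\<rbrakk> \<Longrightarrow> A = A'"
  shows "\<exists>A \<subseteq> U. \<forall>D. P A D \<longrightarrow> card U \<le> length D"
proof (rule ccontr)
  assume "\<not> ?thesis"
  then have "\<forall>A \<in> Pow U. \<exists>D. P A D \<and> length D < card U"
    by (auto simp: not_le)
  then obtain d where d: "\<And>A. A \<in> Pow U \<Longrightarrow> P A (d A) \<and> length (d A) < card U"
    by metis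
  have "inj_on d (Pow U)"
    by (rule inj_onI) (metis PowD d inj)
  moreover have "d ` Pow U \<subseteq> {D. length D < card U}"
    using d by auto
  moreover have "finite {D :: bool list. length D < card U}"
    by (rule finite_subset[OF _ finite_lists_length_le[of "UNIV :: bool set" "card U"]]) auto
  ultimately have "card (Pow U) \<le> card {D :: bool list. length D < card U}"
    by (rule card_inj_on_le)
  with card_bool_lists_shorter[of "card U"] show False
    using \<open>finite U\<close> by (simp add: card_Pow)
qed

section \<open>Minimum cuts\<close>

lemma finite_st_cuts: "finite (verts G) \<Longrightarrow> finite (st_cuts G s t)"
  unfolding st_cuts_def by (rule finite_subset[of _ "Pow (verts G)"]) auto

lemma min_cut_size_le:
  assumes "finite (verts G)" and "C \<in> st_cuts G s t"
  shows "min_cut_size G s t \<le> cut_size G C"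
  unfolding min_cut_size_def using assms by (simp add: finite_st_cuts)

lemma min_cut_size_ge:
  assumes "finite (verts G)" and "s \<in> verts G" and "s \<noteq> t"
    and "\<And>C. C \<in> st_cuts G s t \<Longrightarrow> m \<le> cut_size G C"
  shows "m \<le> min_cut_size G s t"
proof -
  have "{s} \<in> st_cuts G s t"
    using assms(2,3) by (simp add: st_cuts_def)
  then have "st_cuts G s t \<noteq> {}"
    by auto
  with assms show ?thesis
    unfolding min_cut_size_def by (simp add: finite_st_cuts)
qed

section \<open>Blocks in series\<close>

text \<open>A block takes \<open>2 * r + 1\<close> vertices, counting its entry only; the last port
  and the sink are the extra 2. The slack in \<open>r_le\<close> admits
  \<open>k = r = 1\<close>.\<close>

locale block_chain =
  fixes n k r L :: nat
  assumes r_pos: "0 < r"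
    and r_le: "2 * r \<le> k + 1"
    and fits: "L * (2 * r + 1) + 2 \<le> n"
begin

text \<open>Vertex \<open>0\<close> is the sink. The vertex \<open>port l\<close> is the entry of block \<open>l\<close> and the exit of
  block \<open>l - 1\<close>. The inner vertices \<open>a\<^sub>i\<close> and \<open>b\<^sub>j\<close> of block \<open>l\<close> are \<open>inner l i\<close> and
  \<open>inner l (r + j)\<close>.\<close>

definition port :: "nat \<Rightarrow> nat" where
  "port l = 1 + l * (2 * r + 1)"

definition inner :: "nat \<Rightarrow> nat \<Rightarrow> nat" where
  "inner l p = port l + 1 + p"

text \<open>The \<open>k - 2 * r\<close> direct arcs (none if \<open>k + 1 = 2 * r\<close>) raise the capacity of a block to
  at least \<open>k\<close>.\<close>

definition block_arcs :: "(nat \<times> nat \<times> nat) set \<Rightarrow> nat \<Rightarrow> marc set" where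
  "block_arcs B l =
     (\<lambda>d. (port l, port (Suc l), d)) ` {..<k - 2 * r} \<union>
     (\<lambda>p. (port l, inner l p, 0)) ` {..<2 * r} \<union>
     (\<lambda>p. (inner l p, port (Suc l), 0)) ` {..<2 * r} \<union>
     (\<lambda>(i, j). (inner l i, inner l (r + j), 0)) ` {(i, j). i < r \<and> j < r \<and> (l, i, j) \<in> B}"

text \<open>The bundle into the sink pins the min-cut to \<open>k\<close>. Vertices above
  \<open>port L\<close> are isolated padding.\<close>

definition chain :: "(nat \<times> nat \<times> nat) set \<Rightarrow> multidigraph" where
  "chain B = \<lparr>verts = {..<n},
     arcs = (\<lambda>d. (port L, 0, d)) ` {..<k} \<union> (\<Union>l<L. block_arcs B l),
     tail = (\<lambda>(u, v, i). u), head = (\<lambda>(u, v, i). v)\<rparr>"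

text \<open>Since subtraction truncates, this is \<open>max k (2 * r)\<close>.\<close>

definition capacity :: nat where
  "capacity = (k - 2 * r) + 2 * r"

definition failure :: "nat \<Rightarrow> nat \<Rightarrow> nat \<Rightarrow> marc set" where
  "failure l i j = {(inner l i, port (Suc l), 0), (port l, inner l (r + j), 0)}"

section \<open>Vertex layout and well-formedness\<close>

lemma port_mono: "l \<le> l' \<Longrightarrow> port l \<le> port l'"
  unfolding port_def by (intro add_left_mono mult_right_mono) auto

lemma port_Suc: "port (Suc l) = port l + 2 * r + 1"
  by (simp add: port_def)

lemma port_pos: "0 < port l"
  by (simp add: port_def)

lemma port_less: "l \<le> L \<Longrightarrow> port l < n"
  using fits port_mono[of l L] by (simp add: port_def)

lemma k_le_capacity: "k \<le> capacity"
  and capacity_le: "capacity \<le> k + 1"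
  using r_le by (simp_all add: capacity_def)

lemma block_arcs_bounds:
  assumes "(u, v, d) \<in> block_arcs B l"
  shows "port l \<le> u" "u < port (Suc l)" "port l < v" "v \<le> port (Suc l)"
  using assms by (auto simp: block_arcs_def inner_def port_Suc)

lemma finite_block_arcs: "finite (block_arcs B l)"
proof -
  have "finite {(i, j). i < r \<and> j < r \<and> (l, i, j) \<in> B}"
    by (rule finite_subset[of _ "{..<r} \<times> {..<r}"]) auto
  then show ?thesis
    by (simp add: block_arcs_def)
qed

lemma finite_arcs_chain: "finite (arcs (chain B))"
  by (simp add: chain_def finite_block_arcs)

lemma arcs_chain_bounds:
  assumes "(u, v, d) \<in> arcs (chain B)"
  shows "0 < u" "u \<le> port L" "v \<le> port L"
proof -
  consider "u = port L" "v = 0" | l where "l < L" "(u, v, d) \<in> block_arcs B l"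
    using assms by (auto simp: chain_def)
  then have "0 < u \<and> u \<le> port L \<and> v \<le> port L"
  proof cases
    case 1
    then show ?thesis by (simp add: port_pos)
  next
    case (2 l)
    with block_arcs_bounds[OF 2(2)] port_mono[of "Suc l" L] port_pos[of l] show ?thesis
      by linarith
  qed
  then show "0 < u" "u \<le> port L" "v \<le> port L"
    by auto
qed

lemma multidigraph_on_chain: "multidigraph_on n (chain B)"
proof -
  have "fin_digraph (chain B)"
  proof
    fix e assume e: "e \<in> arcs (chain B)"
    obtain u v d where "e = (u, v, d)"
      by (cases e)
    with e arcs_chain_bounds[of u v d B] port_less[of L]
    show "tail (chain B) e \<in> verts (chain B)" "head (chain B) e \<in> verts (chain B)"
      by (auto simp: chain_def)
  qed (simp_all add: finite_arcs_chain, simp add: chain_def)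
  then show ?thesis
    by (simp add: multidigraph_on_def chain_def)
qed

lemma cut_size_chain:
  "cut_size (del_arcs (chain B) F) C =
     card {(u, v, d). (u, v, d) \<in> arcs (chain B) - F \<and> u \<in> C \<and> v \<notin> C}"
  unfolding cut_size_def
  by (rule arg_cong[of _ _ card]) (auto simp: del_arcs_def chain_def)

lemma cut_size_chain_ge:
  assumes "X \<subseteq> arcs (chain B) - F" and "\<And>u v d. (u, v, d) \<in> X \<Longrightarrow> u \<in> C \<and> v \<notin> C"
  shows "card X \<le> cut_size (del_arcs (chain B) F) C"
  unfolding cut_size_chain
proof (rule card_mono)
  show "finite {(u, v, d). (u, v, d) \<in> arcs (chain B) - F \<and> u \<in> C \<and> v \<notin> C}"
    by (rule finite_subset[OF _ finite_arcs_chain[of B]]) auto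
qed (use assms in auto)

section \<open>Crossing arcs of disjoint paths, and the intact min-cut\<close>

definition path_arc :: "nat set \<Rightarrow> nat \<Rightarrow> nat \<Rightarrow> marc" where
  "path_arc C l p =
     (if inner l p \<in> C then (inner l p, port (Suc l), 0) else (port l, inner l p, 0))"

text \<open>If \<open>C\<close> separates entry from exit, these are the direct arcs and the
  crossing arc of each two-arc path indexed by \<open>P\<close>. The set serves to bound cuts from
  below and, after a failure, one chosen cut from above.\<close>

definition paths_cut :: "nat set \<Rightarrow> nat \<Rightarrow> nat set \<Rightarrow> marc set" where
  "paths_cut C l P = (\<lambda>d. (port l, port (Suc l), d)) ` {..<k - 2 * r} \<union> path_arc C l ` P"

lemma card_paths_cut:
  assumes "P \<subseteq> {..<2 * r}"
  shows "card (paths_cut C l P) = (k - 2 * r) + card P"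
proof -
  have "inj_on (path_arc C l) P"
    using assms by (auto simp: inj_on_def path_arc_def inner_def port_Suc split: if_splits)
  moreover have "(\<lambda>d. (port l, port (Suc l), d)) ` {..<k - 2 * r} \<inter> path_arc C l ` P = {}"
    using assms by (auto simp: path_arc_def inner_def port_Suc split: if_splits)
  moreover have "inj_on (\<lambda>d. (port l, port (Suc l), d)) {..<k - 2 * r}"
    by (simp add: inj_on_def)
  moreover have "finite P"
    using assms finite_subset by blast
  ultimately show ?thesis
    unfolding paths_cut_def by (simp add: card_Un_disjoint card_image)
qed

lemma paths_cut_subset:
  assumes "P \<subseteq> {..<2 * r}" and "l < L"
  shows "paths_cut C l P \<subseteq> block_arcs B l" and "paths_cut C l P \<subseteq> arcs (chain B)"
proof -
  show "paths_cut C l P \<subseteq> block_arcs B l"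
    using assms(1) by (auto simp: paths_cut_def path_arc_def block_arcs_def)
  with assms(2) show "paths_cut C l P \<subseteq> arcs (chain B)"
    by (auto simp: chain_def)
qed

lemma paths_cut_crosses:
  assumes "port l \<in> C" and "port (Suc l) \<notin> C" and "(u, v, d) \<in> paths_cut C l P"
  shows "u \<in> C \<and> v \<notin> C"
  using assms by (auto simp: paths_cut_def path_arc_def split: if_splits)

text \<open>Walk along the ports from the source: either all lie in \<open>C\<close>, so the bundle
  is cut, or some block is where the walk leaves \<open>C\<close>.\<close>

lemma cut_cases:
  assumes "C \<in> st_cuts G (port 0) 0"
  obtains "port L \<in> C" "0 \<notin> C" | l where "l < L" "port l \<in> C" "port (Suc l) \<notin> C"
proof (cases "port L \<in> C")
  case True
  with assms that(1) show ?thesis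
    by (auto simp: st_cuts_def)
next
  case False
  have "\<exists>l<L. port l \<in> C \<and> port (Suc l) \<notin> C"
  proof (rule ccontr)
    assume neg: "\<not> ?thesis"
    have "l \<le> L \<Longrightarrow> port l \<in> C" for l
    proof (induction l)
      case 0
      with assms show ?case by (simp add: st_cuts_def)
    next
      case (Suc l)
      with neg show ?case by auto
    qed
    with False show False by simp
  qed
  with that(2) show ?thesis by blast
qed

lemma bundle_cut_size_ge:
  assumes "port L \<in> C" and "0 \<notin> C" and "\<And>d. (port L, 0, d) \<notin> F"
  shows "k \<le> cut_size (del_arcs (chain B) F) C"
proof -
  have "card ((\<lambda>d. (port L, 0::nat, d)) ` {..<k}) = k"
    by (simp add: card_image inj_on_def)
  with cut_size_chain_ge[of "(\<lambda>d. (port L, 0, d)) ` {..<k}" B F C] assms show ?thesis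
    by (auto simp: chain_def)
qed

lemma block_cut_size_ge:
  assumes "l < L" and "port l \<in> C" and "port (Suc l) \<notin> C" and "block_arcs B l \<inter> F = {}"
  shows "capacity \<le> cut_size (del_arcs (chain B) F) C"
proof -
  have "paths_cut C l {..<2 * r} \<subseteq> arcs (chain B) - F"
    using paths_cut_subset[of "{..<2 * r}" l C B] assms(1,4) by auto
  then have "card (paths_cut C l {..<2 * r}) \<le> cut_size (del_arcs (chain B) F) C"
    by (rule cut_size_chain_ge) (rule paths_cut_crosses[OF assms(2,3)])
  then show ?thesis
    by (simp add: card_paths_cut capacity_def)
qed

lemma finite_verts_chain: "finite (verts (chain B))"
  by (simp add: chain_def)

lemma source_in_verts: "port 0 \<in> verts (chain B)"
  and sink_in_verts: "0 \<in> verts (chain B)"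
  using port_less[of 0] by (simp_all add: chain_def)

lemma min_cut_size_chain: "min_cut_size (chain B) (port 0) 0 = k"
proof (rule antisym)
  have del: "del_arcs (chain B) {} = chain B"
    by (simp add: del_arcs_def)
  \<comment> \<open>Everything but the sink: only the bundle enters vertex 0.\<close>
  let ?C = "{1..<n}"
  have "{(u, v, d). (u, v, d) \<in> arcs (chain B) - {} \<and> u \<in> ?C \<and> v \<notin> ?C} \<subseteq>
    (\<lambda>d. (port L, 0, d)) ` {..<k}"
  proof clarify
    fix u v d assume a: "(u, v, d) \<in> arcs (chain B)" and "v \<notin> ?C"
    with arcs_chain_bounds[OF a] port_less[of L] have "v = 0"
      by auto
    with a show "(u, v, d) \<in> (\<lambda>d. (port L, 0, d)) ` {..<k}"
      using block_arcs_bounds(3) by (fastforce simp: chain_def)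
  qed
  then have "cut_size (del_arcs (chain B) {}) ?C \<le> card ((\<lambda>d. (port L, 0::nat, d)) ` {..<k})"
    unfolding cut_size_chain by (intro card_mono) auto
  also have "\<dots> = k"
    by (simp add: card_image inj_on_def)
  finally have "cut_size (chain B) ?C \<le> k"
    by (simp only: del)
  moreover have "?C \<in> st_cuts (chain B) (port 0) 0"
    using port_less[of 0] by (auto simp: st_cuts_def chain_def port_def)
  ultimately show "min_cut_size (chain B) (port 0) 0 \<le> k"
    by (meson finite_verts_chain min_cut_size_le order_trans)
  show "k \<le> min_cut_size (chain B) (port 0) 0"
  proof (rule min_cut_size_ge[OF finite_verts_chain source_in_verts])
    fix C assume "C \<in> st_cuts (chain B) (port 0) 0"
    then show "k \<le> cut_size (chain B) C"
    proof (cases rule: cut_cases)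
      case 1
      with bundle_cut_size_ge[of C "{}" B] show ?thesis by (simp add: del)
    next
      case (2 l)
      with block_cut_size_ge[of l C B "{}"] k_le_capacity show ?thesis by (simp add: del)
    qed
  qed (simp add: port_def)
qed

section \<open>Min-cuts after a failure\<close>

lemma failure_subset:
  assumes "l < L" "i < r" "j < r"
  shows "failure l i j \<subseteq> block_arcs B l" and "failure l i j \<subseteq> arcs (chain B)"
proof -
  show "failure l i j \<subseteq> block_arcs B l"
    using assms(2,3) by (auto simp: failure_def block_arcs_def)
  with assms(1) show "failure l i j \<subseteq> arcs (chain B)"
    by (auto simp: chain_def)
qed

lemma card_failure: "card (failure l i j) = 2"
  by (simp add: failure_def inner_def)

text \<open>The tails of different blocks lie in disjoint intervals between consecutive
  ports.\<close>

lemma block_arcs_disjoint: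
  assumes "l \<noteq> l'"
  shows "block_arcs B l \<inter> block_arcs B l' = {}"
proof -
  have "False" if "(u, v, d) \<in> block_arcs B l" "(u, v, d) \<in> block_arcs B l'" for u v d
    using block_arcs_bounds[OF that(1)] block_arcs_bounds[OF that(2)]
      port_mono[of "Suc l" l'] port_mono[of "Suc l'" l] assms
    by (meson le_less_trans less_le_trans linorder_neqE_nat not_less_iff_gr_or_eq Suc_leI)
  then show ?thesis
    by auto
qed

text \<open>In the damaged block the direct arcs, the \<open>2 * r - 2\<close> intact paths and the
  detour through \<open>a\<^sub>i\<close> and \<open>b\<^sub>j\<close> are arc-disjoint.\<close>

lemma min_cut_size_failure_present:
  assumes "l < L" "i < r" "j < r" and bit: "(l, i, j) \<in> B"
  shows "capacity - 1 \<le> min_cut_size (del_arcs (chain B) (failure l i j)) (port 0) 0"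
proof (rule min_cut_size_ge)
  fix C assume "C \<in> st_cuts (del_arcs (chain B) (failure l i j)) (port 0) 0"
  then show "capacity - 1 \<le> cut_size (del_arcs (chain B) (failure l i j)) C"
  proof (cases rule: cut_cases)
    case 1
    have "(port L, 0, d) \<notin> failure l i j" for d
      by (simp add: failure_def inner_def port_def)
    \<comment> \<open>The bundle is intact, and \<open>capacity\<close> exceeds \<open>k\<close> by
      at most one.\<close>
    with bundle_cut_size_ge[OF 1] capacity_le show ?thesis
      by (metis le_diff_conv order_trans)
  next
    case (2 l')
    show ?thesis
    proof (cases "l' = l")
      case False
      with block_arcs_disjoint[of l' l B] failure_subset(1)[OF assms(1-3), of B]
      have "block_arcs B l' \<inter> failure l i j = {}"
        by auto
      with block_cut_size_ge[OF 2] show ?thesis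
        by (meson diff_le_self le_trans)
    next
      case True
      let ?P = "{..<2 * r} - {i, r + j}"
      \<comment> \<open>Some arc of the path entry -- \<open>a\<^sub>i\<close> -- \<open>b\<^sub>j\<close> -- exit crosses the cut.\<close>
      define e where "e =
        (if inner l i \<notin> C then (port l, inner l i, 0)
         else if inner l (r + j) \<notin> C then (inner l i, inner l (r + j), 0)
         else (inner l (r + j), port (Suc l), 0 :: nat))"
      have P: "?P \<subseteq> {..<2 * r}"
        by auto
      have "e \<in> block_arcs B l"
        using assms(2-4) by (auto simp: e_def block_arcs_def)
      then have e_in: "e \<in> arcs (chain B) - failure l i j"
        using assms(1-3) by (auto simp: chain_def e_def failure_def inner_def port_Suc)
      have e_cross: "u \<in> C \<and> v \<notin> C" if "e = (u, v, d)" for u v d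
        using that 2 True by (auto simp: e_def split: if_splits)
      \<comment> \<open>Every detour arc touches \<open>a\<^sub>i\<close> or
        \<open>b\<^sub>j\<close>, whose own paths \<open>?P\<close> leaves out.\<close>
      have e_new: "e \<notin> paths_cut C l ?P"
      proof
        assume "e \<in> paths_cut C l ?P"
        then show False
          using assms(2,3) by (auto simp: e_def paths_cut_def path_arc_def inner_def port_Suc
              split: if_splits)
      qed
      have "paths_cut C l ?P \<inter> failure l i j = {}"
        using assms(2,3)
        by (auto simp: paths_cut_def failure_def path_arc_def inner_def port_Suc
              split: if_splits)
      with paths_cut_subset(2)[OF P assms(1), of C B] e_in
      have "insert e (paths_cut C l ?P) \<subseteq> arcs (chain B) - failure l i j"
        by auto
      then have "card (insert e (paths_cut C l ?P)) \<le>
          cut_size (del_arcs (chain B) (failure l i j)) C"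
        by (rule cut_size_chain_ge)
          (use e_cross paths_cut_crosses[of l C] 2 True in blast)
      moreover have "finite (paths_cut C l ?P)"
        by (simp add: paths_cut_def)
      moreover have "card ?P = 2 * r - 2"
        using assms(2,3) by (subst card_Diff_subset) auto
      ultimately show ?thesis
        using e_new card_paths_cut[OF P, of C l] r_pos by (simp add: capacity_def)
    qed
  qed
qed (use port_less[of 0] in \<open>simp_all add: del_arcs_def chain_def port_def\<close>)

lemma min_cut_size_failure_absent:
  assumes "l < L" "i < r" "j < r" and bit: "(l, i, j) \<notin> B"
  shows "min_cut_size (del_arcs (chain B) (failure l i j)) (port 0) 0 \<le> capacity - 2"
proof -
  let ?P = "{..<2 * r} - {i, r + j}"
  \<comment> \<open>The two broken paths cross at their failed arcs, for free. Keeping the other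
    \<open>b\<close> vertices inside and the other \<open>a\<close> vertices outside leaves
    \<open>a\<^sub>i \<rightarrow> b\<^sub>j\<close> as the only inner arc that could cross.\<close>
  define C where "C = {1..port l} \<union> {inner l i} \<union> inner l ` ({r..<2 * r} - {r + j})"
  have C_ge: "port (Suc l) > x" if "x \<in> C" for x
    using that assms(2) by (auto simp: C_def inner_def port_Suc)
  have inner_C: "inner l p \<in> C \<longleftrightarrow> p = i \<or> (r \<le> p \<and> p \<noteq> r + j)" if "p < 2 * r" for p
    using that by (auto simp: C_def inner_def)
  have "{(u, v, d). (u, v, d) \<in> arcs (chain B) - failure l i j \<and> u \<in> C \<and> v \<notin> C} \<subseteq>
    paths_cut C l ?P"
  proof clarify
    fix u v d
    assume a: "(u, v, d) \<in> arcs (chain B)" "(u, v, d) \<notin> failure l i j" and C: "u \<in> C" "v \<notin> C"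
    have "u \<noteq> port L"
      using C_ge[OF C(1)] port_mono[of "Suc l" L] assms(1) by auto
    with a(1) obtain l' where "l' < L" and l': "(u, v, d) \<in> block_arcs B l'"
      by (auto simp: chain_def)
    note bounds = block_arcs_bounds[OF l']
    \<comment> \<open>Later blocks have their tails outside \<open>C\<close>, earlier blocks their
      heads inside.\<close>
    have "\<not> l < l'"
      using C_ge[OF C(1)] bounds(1) port_mono[of "Suc l" l'] by auto
    moreover have "\<not> l' < l"
    proof
      assume "l' < l"
      with bounds(3,4) port_mono[of "Suc l'" l] have "v \<in> C"
        by (auto simp: C_def)
      with C(2) show False ..
    qed
    ultimately have "l' = l"
      by simp
    with l' have "(u, v, d) \<in> block_arcs B l"
      by simp
    then consider
        "d < k - 2 * r" "u = port l" "v = port (Suc l)"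
      | p where "p < 2 * r" "u = port l" "v = inner l p" "d = 0"
      | p where "p < 2 * r" "u = inner l p" "v = port (Suc l)" "d = 0"
      | i' j' where "i' < r" "j' < r" "(l, i', j') \<in> B" "u = inner l i'" "v = inner l (r + j')"
      by (auto simp: block_arcs_def)
    then show "(u, v, d) \<in> paths_cut C l ?P"
    proof cases
      case 1
      then show ?thesis by (auto simp: paths_cut_def)
    next
      case (2 p)
      with a(2) C inner_C have "p \<in> ?P" "(u, v, d) = path_arc C l p"
        by (auto simp: failure_def path_arc_def)
      then show ?thesis by (auto simp: paths_cut_def)
    next
      case (3 p)
      with a(2) C inner_C have "p \<in> ?P" "(u, v, d) = path_arc C l p"
        by (auto simp: failure_def path_arc_def)
      then show ?thesis by (auto simp: paths_cut_def)
    next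
      case (4 i' j')
      with C inner_C[of i'] inner_C[of "r + j'"] have "i' = i" "j' = j"
        by auto
      with 4 bit show ?thesis by simp
    qed
  qed
  then have "cut_size (del_arcs (chain B) (failure l i j)) C \<le> card (paths_cut C l ?P)"
    unfolding cut_size_chain by (intro card_mono) (auto simp: paths_cut_def)
  also have "\<dots> = (k - 2 * r) + card ?P"
    by (rule card_paths_cut) auto
  also have "card ?P = 2 * r - 2"
    using assms(2,3) by (subst card_Diff_subset) auto
  also have "(k - 2 * r) + (2 * r - 2) = capacity - 2"
    using r_pos by (simp add: capacity_def)
  finally have "cut_size (del_arcs (chain B) (failure l i j)) C \<le> capacity - 2" .
  moreover have "C \<in> st_cuts (del_arcs (chain B) (failure l i j)) (port 0) 0"
  proof -
    have "x < n" if "x \<in> C" for x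
      using C_ge[OF that] port_less[of "Suc l"] assms(1) by simp
    then show ?thesis
      using port_mono[of 0 l] by (auto simp: st_cuts_def del_arcs_def chain_def C_def port_def inner_def)
  qed
  moreover have "finite (verts (del_arcs (chain B) (failure l i j)))"
    by (simp add: del_arcs_def chain_def)
  ultimately show ?thesis
    by (meson min_cut_size_le order_trans)
qed

section \<open>Recovering the relation from an oracle\<close>

lemma oracle_determines_bits:
  assumes "dual_ft_oracle M (chain B) (port 0) 0 D" and "dual_ft_oracle M (chain B') (port 0) 0 D"
    and "l < L" "i < r" "j < r" and "(l, i, j) \<in> B"
  shows "(l, i, j) \<in> B'"
proof (rule ccontr)
  assume "(l, i, j) \<notin> B'"
  \<comment> \<open>The failed arcs exist in both chains, so one string gives one answer to the same
    query in both.\<close>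
  then have "M D (port 0) 0 (failure l i j) \<le> capacity - 2"
    using min_cut_size_failure_absent assms(2-5) failure_subset(2)[OF assms(3-5)] card_failure
    unfolding dual_ft_oracle_def by metis
  moreover have "capacity - 1 \<le> M D (port 0) 0 (failure l i j)"
    using min_cut_size_failure_present assms(1,3-6) failure_subset(2)[OF assms(3-5)] card_failure
    unfolding dual_ft_oracle_def by metis
  \<comment> \<open>Keeps the two truncated differences distinct.\<close>
  moreover have "2 \<le> capacity"
    using r_pos by (simp add: capacity_def)
  ultimately show False
    by simp
qed

lemma exists_chain_with_large_oracles:
  "\<exists>B. \<forall>D. dual_ft_oracle M (chain B) (port 0) 0 D \<longrightarrow> L * r * r \<le> length D"
proof -
  let ?U = "{..<L} \<times> {..<r} \<times> {..<r}"
  have "\<exists>B \<subseteq> ?U. \<forall>D. dual_ft_oracle M (chain B) (port 0) 0 D \<longrightarrow> card ?U \<le> length D"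
  proof (rule exists_subset_with_long_codes)
    fix B B' D
    assume "B \<subseteq> ?U" "B' \<subseteq> ?U"
      and "dual_ft_oracle M (chain B) (port 0) 0 D" "dual_ft_oracle M (chain B') (port 0) 0 D"
    then show "B = B'"
      using oracle_determines_bits by blast
  qed simp
  then show ?thesis
    by (auto simp: card_cartesian_product mult.assoc)
qed

end

section \<open>The lower bound\<close>

lemma block_count_bound:
  fixes n k r :: nat
  assumes "9 \<le> n" and "k \<le> n" and r: "r = (k + 3) div 4" and "0 < r"
  shows "k * n \<le> 48 * (((n - 2) div (2 * r + 1)) * r * r)"
proof -
  let ?m = "2 * r + 1"
  let ?L = "(n - 2) div ?m"
  \<comment> \<open>Room for one block; this is where \<open>9 \<le> n\<close> comes from.\<close>
  have "?m \<le> n - 2"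
    using assms by linarith
  then have "1 \<le> ?L"
    by (simp add: Suc_le_eq div_greater_zero_iff)
  \<comment> \<open>With at least one block, rounding down costs at most a factor 2. The final 48 is
    12 from \<open>n \<le> 12 * ?L * r\<close> times 4 from \<open>k \<le> 4 * r\<close>.\<close>
  have "n - 2 \<le> ?L * ?m + 1 * ?m"
    using dividend_less_div_times[of ?m "n - 2"] by (simp add: add.commute)
  also have "\<dots> \<le> ?L * ?m + ?L * ?m"
    using \<open>1 \<le> ?L\<close> by (intro add_mono mult_right_mono) auto
  also have "\<dots> = 2 * ?L * ?m"
    by simp
  also have "\<dots> \<le> 2 * ?L * (3 * r)"
    using \<open>0 < r\<close> by (intro mult_left_mono) auto
  finally have "n \<le> 12 * ?L * r"
    using \<open>9 \<le> n\<close> by linarith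
  moreover have "k \<le> 4 * r"
    unfolding r by linarith
  ultimately have "k * n \<le> (4 * r) * (12 * ?L * r)"
    by (intro mult_mono) auto
  then show ?thesis
    by (simp add: ac_simps)
qed

theorem theorem4:
  shows "\<exists>c::real. c > 0 \<and> (\<exists>N::nat. \<forall>(M::machine) (n::nat) (k::nat).
           2 \<le> n \<and> 1 \<le> k \<and> k \<le> n \<longrightarrow>
           (\<exists>G s t. multidigraph_on n G \<and> s \<in> verts G \<and> t \<in> verts G \<and> s \<noteq> t \<and>
              min_cut_size G s t = k \<and>
              (N \<le> n \<longrightarrow>
                (\<forall>D. dual_ft_oracle M G s t D \<longrightarrow> c * real k * real n \<le> real (length D)))))"
proof (intro exI[of _ "1 / 48 :: real"] conjI exI[of _ "9 :: nat"] allI impI)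
  fix M :: machine and n k :: nat
  assume nk: "2 \<le> n \<and> 1 \<le> k \<and> k \<le> n"
  \<comment> \<open>This is \<open>k / 4\<close> rounded up, hence positive even for
    \<open>k = 1\<close>.\<close>
  define r where "r = (k + 3) div 4"
  \<comment> \<open>As many blocks as fit. For small \<open>n\<close> this may be 0; the bundle
    alone then still gives min-cut \<open>k\<close>.\<close>
  define L where "L = (n - 2) div (2 * r + 1)"
  have "0 < r"
    using nk unfolding r_def by linarith
  interpret block_chain n k r L
  proof
    show "2 * r \<le> k + 1"
      using nk unfolding r_def by linarith
    have "L * (2 * r + 1) \<le> n - 2"
      unfolding L_def by (rule div_times_less_eq_dividend)
    then show "L * (2 * r + 1) + 2 \<le> n"
      using nk by linarith
  qed fact
  obtain B where B: "\<And>D. dual_ft_oracle M (chain B) (port 0) 0 D \<Longrightarrow> L * r * r \<le> length D"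
    using exists_chain_with_large_oracles by blast
  have "1 / 48 * real k * real n \<le> real (length D)"
    if "9 \<le> n" and "dual_ft_oracle M (chain B) (port 0) 0 D" for D
  proof -
    have "k * n \<le> 48 * (L * r * r)"
      unfolding L_def using block_count_bound[OF that(1) _ r_def \<open>0 < r\<close>] nk by blast
    also have "\<dots> \<le> 48 * length D"
      using B[OF that(2)] by simp
    finally have "real (k * n) \<le> real (48 * length D)"
      by (rule of_nat_mono)
    then show ?thesis
      by simp
  qed
  then show "\<exists>G s t. multidigraph_on n G \<and> s \<in> verts G \<and> t \<in> verts G \<and> s \<noteq> t \<and>
      min_cut_size G s t = k \<and>
      (9 \<le> n \<longrightarrow> (\<forall>D. dual_ft_oracle M G s t D \<longrightarrow> 1 / 48 * real k * real n \<le> real (length D)))"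
    using multidigraph_on_chain source_in_verts sink_in_verts min_cut_size_chain port_pos
    by (intro exI[of _ "chain B"] exI[of _ "port 0"] exI[of _ 0]) auto
qed simp

end
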